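(* Every graph $G$ without isolated edges can be decomposed into $24$ subgraphs each of which fulfills the 1--2--3 Conjecture.
   Context: All graphs are finite and simple. An isolated edge of a graph is a connected component isomorphic to $K_2$. A decomposition of a graph $G=(V,E)$ into $k$ subgraphs is a partition $E=E_1\cup\dots\cup E_k$ (parts may be empty), the subgraphs being $G_i=(V,E_i)$. For an edge-weighting $\omega:E\to\{1,2,3\}$, the sum at $v$ is $s_\omega(v)=\sum_{e\ni v}\omega(e)$. A graph fulfills the 1--2--3 Conjecture if there exists $\omega:E\to\{1,2,3\}$ with $s_\omega(u)\neq s_\omega(v)$ for every edge $uv$ (an edgeless graph fulfills it trivially). *)

theory Defs
  imports "HOL-Library.Disjoint_Sets"
begin

text \<open>
  A graph is given by its vertex set and its set of edges, each edge being the two-element set of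
  its end vertices.
\<close>

definition two_subsets :: "'a set \<Rightarrow> 'a set set" where
  "two_subsets A = {e. e \<subseteq> A \<and> card e = 2}"

definition simple_graph :: "'a set \<Rightarrow> 'a set set \<Rightarrow> bool" where
  "simple_graph V E \<longleftrightarrow> finite V \<and> E \<subseteq> two_subsets V"

definition connectivity :: "'a set \<Rightarrow> 'a set set \<Rightarrow> ('a \<times> 'a) set" where
  "connectivity V E = {(u, v). u \<in> V \<and> v \<in> V \<and> (u, v) \<in> {(x, y). {x, y} \<in> E}\<^sup>*}"

text \<open>
  Connected components are represented by their vertex sets; the component with vertex set
  \<open>C\<close> is the subgraph induced by \<open>C\<close>.
\<close>

definition components :: "'a set \<Rightarrow> 'a set set \<Rightarrow> 'a set set" where
  "components V E = V // connectivity V E"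

definition induced_edges :: "'a set set \<Rightarrow> 'a set \<Rightarrow> 'a set set" where
  "induced_edges E C = {e \<in> E. e \<subseteq> C}"

definition graph_isomorphic :: "'a set \<Rightarrow> 'a set set \<Rightarrow> 'b set \<Rightarrow> 'b set set \<Rightarrow> bool" where
  "graph_isomorphic V E W F \<longleftrightarrow>
    (\<exists>f. bij_betw f V W \<and> (\<forall>u\<in>V. \<forall>v\<in>V. {u, v} \<in> E \<longleftrightarrow> {f u, f v} \<in> F))"

text \<open>\<open>K\<^sub>2\<close> is taken on the vertex set \<open>{..<2}\<close>.\<close>

definition isolated_edge :: "'a set \<Rightarrow> 'a set set \<Rightarrow> 'a set \<Rightarrow> bool" where
  "isolated_edge V E C \<longleftrightarrow> C \<in> components V E \<and>
    graph_isomorphic C (induced_edges E C) {..<2::nat} (two_subsets {..<2})"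

definition weighted_degree :: "'a set set \<Rightarrow> ('a set \<Rightarrow> nat) \<Rightarrow> 'a \<Rightarrow> nat" where
  "weighted_degree E \<omega> v = (\<Sum>e | e \<in> E \<and> v \<in> e. \<omega> e)"

text \<open>The values of \<open>\<omega>\<close> outside \<open>E\<close> are irrelevant.\<close>

definition fulfills_123 :: "'a set \<Rightarrow> 'a set set \<Rightarrow> bool" where
  "fulfills_123 V E \<longleftrightarrow> (\<exists>\<omega>. (\<forall>e\<in>E. \<omega> e \<in> {1, 2, 3}) \<and>
    (\<forall>u\<in>V. \<forall>v\<in>V. {u, v} \<in> E \<longrightarrow> weighted_degree E \<omega> u \<noteq> weighted_degree E \<omega> v))"

text \<open>The parts \<open>D i\<close> of a decomposition may be empty.\<close>

definition decomposition :: "'a set set \<Rightarrow> nat \<Rightarrow> (nat \<Rightarrow> 'a set set) \<Rightarrow> bool" where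
  "decomposition E k D \<longleftrightarrow> (\<Union>i<k. D i) = E \<and> disjoint_family_on D {..<k}"

end

theory Submission
  imports Defs
begin

text \<open>
  A maximum cut of the graph has edges \<open>F\<close> that leave no \<open>K\<^sub>2\<close> component and touch every edge. Split
  the vertices into five classes so that the other edges have as few ends in a common class as
  possible. A vertex of class \<open>i\<close> then has at least twice as many neighbours in the classes \<open>i + 1\<close> and
  \<open>i + 2\<close> (modulo 5) together as in its own class. So the edges inside class \<open>i\<close> can be weighted by 2
  and distinguished by means of the edges to those two classes, with even sums in class \<open>i\<close> and odd
  sums opposite. This gives five parts containing all edges inside the classes.

  What is left over contains \<open>F\<close> and is properly coloured by the side of the cut together with the
  class, in ten colours. Orienting it so that each in-degree is 0 or at least 2, up to one vertex
  per component, and sorting the edges by the colour of their head gives ten bipartite graphs in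
  which one side has no vertex of degree 1, and one further part for the exceptions: 16 parts.
\<close>

section \<open>Edges, degrees and list colouring\<close>

definition degree :: "'a set set \<Rightarrow> 'a \<Rightarrow> nat" where
  "degree E v = card {e \<in> E. v \<in> e}"

lemma finite_edges: "simple_graph V E \<Longrightarrow> finite E"
  unfolding simple_graph_def two_subsets_def
  by (metis (no_types, lifting) Collect_subset finite_Pow_iff finite_subset Pow_def mem_Collect_eq subset_eq)

lemma two_subsetsE:
  assumes "e \<in> two_subsets V"
  obtains u v where "e = {u, v}" "u \<noteq> v" "u \<in> V" "v \<in> V"
  using assms unfolding two_subsets_def by (auto simp: card_2_iff)

lemma two_subsets_otherE:
  assumes "e \<in> two_subsets V" "x \<in> e"
  obtains y where "e = {x, y}" "y \<noteq> x" "y \<in> V"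
proof -
  obtain u v where uv: "e = {u, v}" "u \<noteq> v" "u \<in> V" "v \<in> V" using assms(1) by (rule two_subsetsE)
  show ?thesis
  proof (cases "x = u")
    case True
    then show ?thesis using that[of v] uv by auto
  next
    case False
    then show ?thesis using that[of u] uv assms(2) by (auto simp: insert_commute)
  qed
qed

lemma degree_Un:
  assumes "finite A" "finite B" "A \<inter> B = {}"
  shows "degree (A \<union> B) v = degree A v + degree B v"
proof -
  have "{e \<in> A \<union> B. v \<in> e} = {e \<in> A. v \<in> e} \<union> {e \<in> B. v \<in> e}" by auto
  moreover have "card ({e \<in> A. v \<in> e} \<union> {e \<in> B. v \<in> e}) = degree A v + degree B v"
    unfolding degree_def using assms by (intro card_Un_disjoint) auto
  ultimately show ?thesis by (simp add: degree_def)
qed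

lemma sum_of_bool_degree:
  assumes "finite E" "A \<subseteq> E"
  shows "(\<Sum>e | e \<in> E \<and> v \<in> e. of_bool (e \<in> A)) = degree A v"
proof -
  have "{e \<in> E. v \<in> e} \<inter> A = {e \<in> A. v \<in> e}" using assms by auto
  then show ?thesis using assms by (simp add: degree_def Int_def)
qed

text \<open>Greedy choice: the vertex inserted last has more admissible values than neighbours, so
  one of its values is not taken by any of them.\<close>

lemma list_colouring:
  fixes A :: "'a \<Rightarrow> nat set"
  assumes "finite S"
    and "\<And>s. s \<in> S \<Longrightarrow> finite (A s)"
    and "\<And>s. s \<in> S \<Longrightarrow> card {t \<in> S. {s, t} \<in> E} < card (A s)"
  shows "\<exists>f. (\<forall>s\<in>S. f s \<in> A s) \<and> (\<forall>s\<in>S. \<forall>t\<in>S. s \<noteq> t \<longrightarrow> {s, t} \<in> E \<longrightarrow> f s \<noteq> f t)"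
  using assms
proof (induction S rule: finite_induct)
  case (insert x S)
  have "card {t \<in> S. {s, t} \<in> E} < card (A s)" if "s \<in> S" for s
  proof -
    have "card {t \<in> S. {s, t} \<in> E} \<le> card {t \<in> insert x S. {s, t} \<in> E}"
      using insert.hyps by (intro card_mono) auto
    then show ?thesis using insert.prems(2)[of s] that by simp
  qed
  then obtain f where f: "\<forall>s\<in>S. f s \<in> A s"
      "\<forall>s\<in>S. \<forall>t\<in>S. s \<noteq> t \<longrightarrow> {s, t} \<in> E \<longrightarrow> f s \<noteq> f t"
    using insert by auto
  let ?N = "{t \<in> insert x S. {x, t} \<in> E}"
  have "card (f ` ?N) \<le> card ?N" using insert.hyps by (intro card_image_le) auto
  also have "\<dots> < card (A x)" using insert.prems by simp
  finally have "\<not> A x \<subseteq> f ` ?N"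
    using insert.hyps by (metis (no_types, lifting) card_mono finite.insertI finite_imageI
        finite_subset leD mem_Collect_eq subsetI)
  then obtain y where y: "y \<in> A x" "y \<notin> f ` ?N" by blast
  show ?case
    by (rule exI[of _ "f(x := y)"]) (use f y insert.hyps in \<open>auto simp: insert_commute\<close>)
qed simp

section \<open>Bipartite graphs\<close>

text \<open>Weights modulo 3: all sums over \<open>A\<close> stay divisible by 3, and a vertex outside \<open>A\<close> whose sum is
  divisible by 3 is repaired by shifting weight along a path of length two centred in \<open>A\<close>.\<close>

lemma bipartite_mod_3:
  assumes "finite V" "finite E"
    and bip: "\<And>e. e \<in> E \<Longrightarrow> \<exists>a b. e = {a, b} \<and> a \<in> A \<and> b \<in> V - A"
    and deg: "\<And>a. a \<in> A \<Longrightarrow> degree E a \<noteq> 1"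
  shows "\<exists>g. (\<forall>a\<in>A. 3 dvd weighted_degree E g a) \<and>
    (\<forall>b. b \<notin> A \<longrightarrow> degree E b \<noteq> 0 \<longrightarrow> \<not> 3 dvd weighted_degree E g b)"
proof -
  define ok where "ok g \<longleftrightarrow> (\<forall>a\<in>A. 3 dvd weighted_degree E g a)" for g
  define bad where "bad g = {b. b \<notin> A \<and> degree E b \<noteq> 0 \<and> 3 dvd weighted_degree E g b}" for g
  have "ok (\<lambda>_. 0)" by (simp add: ok_def weighted_degree_def)
  then obtain g where g: "ok g" and least: "\<And>g'. ok g' \<Longrightarrow> card (bad g) \<le> card (bad g')"
    using ex_has_least_nat[of ok _ "\<lambda>g. card (bad g)"] by blast
  have nonempty: "\<exists>e\<in>E. v \<in> e" if "degree E v \<noteq> 0" for v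
  proof -
    have "{e \<in> E. v \<in> e} \<noteq> {}" using that unfolding degree_def by (metis card.empty)
    then show ?thesis by auto
  qed
  have "bad g \<subseteq> V" using nonempty bip by (fastforce simp: bad_def)
  then have fin: "finite (bad g)" using assms(1) finite_subset by blast
  have "bad g = {}"
  proof (rule ccontr)
    assume "bad g \<noteq> {}"
    then obtain b where b: "b \<in> bad g" by blast
    then have "b \<notin> A" "degree E b \<noteq> 0" by (auto simp: bad_def)
    then obtain a where a: "{a, b} \<in> E" "a \<in> A" using nonempty[of b] bip by fastforce
    have "{e \<in> E. a \<in> e} \<noteq> {{a, b}}" using deg[OF a(2)] unfolding degree_def
      by (metis One_nat_def card_1_singleton_iff)
    then obtain e where e: "e \<in> E" "a \<in> e" "e \<noteq> {a, b}" using a by auto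
    then obtain b' where b': "e = {a, b'}" "b' \<notin> A" using bip[OF e(1)] a by auto
    have "b' \<noteq> b" "a \<noteq> b" "a \<noteq> b'" using e b' a \<open>b \<notin> A\<close> by auto
    \<comment> \<open>Here \<open>b\<close> starts at residue 0 and receives \<open>d\<close>,
      \<open>b'\<close> receives \<open>3 - d\<close>, and \<open>a\<close> receives 3 in total.
      Adding 2 brings \<open>b'\<close> to residue 0 only from residue 1, and in that case 1 is
      added instead.\<close>
    define d :: nat where "d = (if weighted_degree E g b' mod 3 = 1 then 2 else 1)"
    define g' where "g' x = g x + (if x = {a, b} then d else 0) + (if x = {a, b'} then 3 - d else 0)" for x
    have wd: "weighted_degree E g' v = weighted_degree E g v
        + (if v \<in> {a, b} then d else 0) + (if v \<in> {a, b'} then 3 - d else 0)" for v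
      using a e b' assms(2)
      by (simp add: weighted_degree_def g'_def sum.distrib sum.delta)
    have d3: "d \<le> 3" by (simp add: d_def)
    have "ok g'" using g \<open>b \<notin> A\<close> b' d3 by (auto simp: ok_def wd)
    moreover have "b \<notin> bad g'"
      using b \<open>b' \<noteq> b\<close> \<open>a \<noteq> b\<close> by (auto simp: bad_def wd d_def dvd_add_right_iff split: if_splits)
    moreover have "b' \<notin> bad g'"
      using \<open>b' \<noteq> b\<close> \<open>a \<noteq> b'\<close> by (auto simp: bad_def wd d_def split: if_splits; presburger)
    moreover have "v \<in> bad g" if "v \<in> bad g'" "v \<noteq> b" "v \<noteq> b'" for v
      using that a(2) by (cases "v = a") (auto simp: bad_def wd)
    ultimately have "bad g' \<subseteq> bad g - {b}" by blast
    then have "card (bad g') < card (bad g)"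
      using b fin by (meson Diff_subset card_Diff1_less card_mono finite_Diff le_less_trans)
    with least[OF \<open>ok g'\<close>] show False by simp
  qed
  then show ?thesis using g by (intro exI[of _ g]) (auto simp: ok_def bad_def)
qed

text \<open>Only residues modulo 3 matter: every edge joins a sum divisible by 3 in \<open>A\<close>
  to one that is not. The residue 0 is realised by the weight 3.\<close>

lemma fulfills_123_bipartite:
  assumes "finite V" "finite E"
    and bip: "\<And>e. e \<in> E \<Longrightarrow> \<exists>a b. e = {a, b} \<and> a \<in> A \<and> b \<in> V - A"
    and deg: "\<And>a. a \<in> A \<Longrightarrow> degree E a \<noteq> 1"
  shows "fulfills_123 V E"
proof -
  obtain g where g: "\<forall>a\<in>A. 3 dvd weighted_degree E g a"
      "\<forall>b. b \<notin> A \<longrightarrow> degree E b \<noteq> 0 \<longrightarrow> \<not> 3 dvd weighted_degree E g b"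
    using bipartite_mod_3[of V E A] assms by blast
  define \<omega> where "\<omega> e = (if g e mod 3 = 0 then 3 else g e mod 3)" for e
  have "\<omega> e mod 3 = g e mod 3" for e by (simp add: \<omega>_def)
  then have "weighted_degree E \<omega> v mod 3 = weighted_degree E g v mod 3" for v
    unfolding weighted_degree_def by (subst (1 2) mod_sum_eq[symmetric]) simp
  then have dvd: "3 dvd weighted_degree E \<omega> v \<longleftrightarrow> 3 dvd weighted_degree E g v" for v
    by (simp add: dvd_eq_mod_eq_0)
  have "\<omega> e \<in> {1, 2, 3}" for e by (auto simp: \<omega>_def)
  moreover have "weighted_degree E \<omega> u \<noteq> weighted_degree E \<omega> v" if "{u, v} \<in> E" for u v
  proof -
    have neq: "weighted_degree E \<omega> a \<noteq> weighted_degree E \<omega> b"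
      if "{a, b} \<in> E" "a \<in> A" "b \<notin> A" for a b
    proof -
      have "degree E b \<noteq> 0" using that assms(2) by (auto simp: degree_def)
      then show ?thesis using g that dvd by metis
    qed
    from bip[OF that] have "u \<in> A \<and> v \<notin> A \<or> v \<in> A \<and> u \<notin> A" by (auto simp: doubleton_eq_iff)
    then show ?thesis using neq[of u v] neq[of v u] that by (auto simp: insert_commute)
  qed
  ultimately show ?thesis unfolding fulfills_123_def by blast
qed

section \<open>Graphs with many edges to an independent set\<close>

text \<open>The edges in \<open>J\<close> get weight 1 or 3, the other edges of \<open>B\<close> weight 0 (dropped) or 2. Maximality of
  \<open>J\<close> makes each \<open>s \<in> S\<close> lose at most one edge to vertices of \<open>T\<close> that \<open>J\<close> misses, and the choice between the
  two weights lets the sums on \<open>S\<close> be chosen greedily without changing any parity.\<close>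

lemma fulfills_123_cut:
  fixes S T V :: "'a set"
  assumes fin: "finite S" "finite T" and ST: "S \<inter> T = {}"
    and I: "I \<subseteq> two_subsets S"
    and B: "\<And>e. e \<in> B \<Longrightarrow> \<exists>s\<in>S. \<exists>t\<in>T. e = {s, t}"
    and deg: "\<And>s. s \<in> S \<Longrightarrow> 2 * degree I s \<le> degree B s"
  shows "\<exists>M. I \<subseteq> M \<and> M \<subseteq> I \<union> B \<and> fulfills_123 V M"
proof -
  have finI: "finite I" using finite_edges[of S I] I fin by (simp add: simple_graph_def)
  have "B \<subseteq> Pow (S \<union> T)" using B by fastforce
  then have finB: "finite B" using fin by (meson finite_Pow_iff finite_UnI finite_subset)
  have Bs: "\<exists>t\<in>T. e = {s, t}" if "e \<in> B" "s \<in> e" "s \<in> S" for e s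
    using B[OF that(1)] that(2,3) ST by auto
  \<comment> \<open>\<open>J\<close> is to be the set of edges of odd weight: sums on
    \<open>S\<close> stay even, and a vertex of \<open>T\<close> gets an odd sum when
    \<open>J\<close> meets it.\<close>
  define ok where "ok J \<longleftrightarrow> J \<subseteq> B \<and> (\<forall>s\<in>S. even (degree J s)) \<and> (\<forall>t\<in>T. degree J t \<le> 1)" for J
  have "ok {}" by (simp add: ok_def degree_def)
  moreover have "\<forall>J. ok J \<longrightarrow> card J < Suc (card B)"
    using finB card_mono by (auto simp: ok_def less_Suc_eq_le)
  ultimately obtain J where J: "ok J" and maxi: "\<And>J'. ok J' \<Longrightarrow> card J' \<le> card J"
    using ex_has_greatest_nat[of ok "{}" card] by blast
  have JB: "J \<subseteq> B" and finJ: "finite J" using J finB finite_subset by (auto simp: ok_def)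
  \<comment> \<open>Edges are kept only if \<open>J\<close> meets their end in \<open>T\<close>;
    that end stays odd however many weights are raised by 2.\<close>
  define B' where "B' = {e \<in> B. \<exists>t\<in>T. t \<in> e \<and> degree J t = 1}"
  have finB': "finite B'" and B'B: "B' \<subseteq> B" using finB by (auto simp: B'_def)
  have JB': "J \<subseteq> B'"
  proof
    fix e assume e: "e \<in> J"
    then obtain s t where st: "e = {s, t}" "t \<in> T" using B JB by blast
    have "degree J t \<noteq> 0" using e st finJ by (auto simp: degree_def)
    moreover have "degree J t \<le> 1" using J st by (auto simp: ok_def)
    ultimately show "e \<in> B'" using e st JB by (auto simp: B'_def)
  qed
  \<comment> \<open>Otherwise both edges could join \<open>J\<close>: the degree grows by 2 at
    \<open>s\<close> and from 0 to 1 at \<open>t\<close> and \<open>t'\<close>.\<close>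
  have uniq: "t = t'" if s: "s \<in> S" and t: "t \<in> T" "t' \<in> T" and e: "{s, t} \<in> B" "{s, t'} \<in> B"
    and z: "degree J t = 0" "degree J t' = 0" for s t t'
  proof (rule ccontr)
    assume neq: "t \<noteq> t'"
    let ?P = "{{s, t}, {s, t'}}"
    have nst: "s \<noteq> t" "s \<noteq> t'" using s t ST by auto
    have new: "{s, t} \<notin> J" "{s, t'} \<notin> J" using z finJ by (auto simp: degree_def)
    have dU: "degree (J \<union> ?P) v = degree J v + degree ?P v" for v
      using new finJ by (intro degree_Un) auto
    have two: "card ?P = 2" using neq nst by (auto simp: doubleton_eq_iff)
    have dP: "degree ?P v = (if v = s then 2 else if v = t \<or> v = t' then 1 else 0)" for v
    proof -
      have "{e \<in> ?P. v \<in> e} = (if v = s then ?P else if v = t then {{s, t}} else if v = t' then {{s, t'}} else {})"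
        using neq nst by auto
      then show ?thesis using two by (auto simp: degree_def)
    qed
    have "ok (J \<union> ?P)"
      using J e s t z ST unfolding ok_def dU dP by (auto simp: disjoint_iff)
    moreover have "card (J \<union> ?P) = card J + 2"
      using new two finJ by (subst card_Un_disjoint) auto
    ultimately show False using maxi by fastforce
  qed
  \<comment> \<open>At most one edge at \<open>s\<close> is lost, and \<open>2 * d <= b' + 1\<close>
    implies \<open>d <= b'\<close> for natural numbers, also when \<open>d = 0\<close>.\<close>
  have degB': "degree I s \<le> degree B' s" if s: "s \<in> S" for s
  proof -
    have "degree (B - B') s \<le> 1"
    proof -
      have "e = e'" if e: "e \<in> B - B'" "e' \<in> B - B'" "s \<in> e" "s \<in> e'" for e e'
      proof -
        obtain t where t: "t \<in> T" "e = {s, t}" using e Bs[of e s] s by auto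
        obtain t' where t': "t' \<in> T" "e' = {s, t'}" using e Bs[of e' s] s by auto
        have "degree J t \<le> 1" "degree J t' \<le> 1" using J t t' by (auto simp: ok_def)
        moreover have "degree J t \<noteq> 1" "degree J t' \<noteq> 1" using that t t' by (auto simp: B'_def)
        ultimately show ?thesis using uniq[of s t t'] t t' s that by auto
      qed
      then show ?thesis unfolding degree_def using finB by (simp add: card_le_Suc0_iff_eq)
    qed
    moreover have "degree B s = degree B' s + degree (B - B') s"
      using degree_Un[of B' "B - B'" s] finB finB' B'B by (simp add: Un_absorb1)
    ultimately show ?thesis using deg[OF s] by linarith
  qed
  \<comment> \<open>\<open>base s\<close> is the sum at \<open>s\<close> with weight 2 on
    \<open>I\<close> and 1 on \<open>J\<close>. Raising up to \<open>degree B' s\<close> edges by 2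
    gives the values in \<open>A s\<close>, which outnumber the neighbours of \<open>s\<close> in
    \<open>I\<close>.\<close>
  define base where "base s = 2 * degree I s + degree J s" for s
  define A where "A s = (\<lambda>j. base s + 2 * j) ` {..degree B' s}" for s
  have "card {t \<in> S. {s, t} \<in> I} < card (A s)" if "s \<in> S" for s
  proof -
    have "card {t \<in> S. {s, t} \<in> I} \<le> degree I s"
      unfolding degree_def using finI
      by (intro card_inj_on_le[of "\<lambda>t. {s, t}"]) (auto simp: inj_on_def doubleton_eq_iff)
    also have "\<dots> < card (A s)"
      using degB'[OF that] unfolding A_def by (subst card_image) (auto simp: inj_on_def)
    finally show ?thesis .
  qed
  then obtain f where f: "\<forall>s\<in>S. f s \<in> A s"
      "\<forall>s\<in>S. \<forall>t\<in>S. s \<noteq> t \<longrightarrow> {s, t} \<in> I \<longrightarrow> f s \<noteq> f t"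
    using list_colouring[of S A I] fin by (auto simp: A_def)
  have "\<exists>H. H \<subseteq> {e \<in> B'. s \<in> e} \<and> f s = base s + 2 * card H" if "s \<in> S" for s
  proof -
    have "f s \<in> A s" using f that by blast
    then obtain j where "j \<le> degree B' s" "f s = base s + 2 * j" by (auto simp: A_def)
    then show ?thesis using obtain_subset_with_card_n[of j "{e \<in> B'. s \<in> e}"]
      by (metis degree_def)
  qed
  then obtain K where K: "\<And>s. s \<in> S \<Longrightarrow> K s \<subseteq> {e \<in> B'. s \<in> e}"
      "\<And>s. s \<in> S \<Longrightarrow> f s = base s + 2 * card (K s)"
    by metis
  \<comment> \<open>The raised edges. Each edge of \<open>B\<close> has just one end in
    \<open>S\<close>, so the choices made at different vertices of \<open>S\<close> do not
    interfere.\<close>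
  define H where "H = (\<Union>s\<in>S. K s)"
  have HB': "H \<subseteq> B'" using K by (auto simp: H_def)
  have "{e \<in> H. s \<in> e} = K s" if s: "s \<in> S" for s
  proof -
    have "e \<in> K s" if e: "e \<in> K s'" "s' \<in> S" "s \<in> e" for e s'
    proof -
      have "e \<in> B" "s' \<in> e" using K e B'B by auto
      then have "s = s'" using Bs[of e s'] e s ST by auto
      then show ?thesis using e by simp
    qed
    then show ?thesis using K[OF s] s by (auto simp: H_def)
  qed
  then have degH: "degree H s = card (K s)" if "s \<in> S" for s
    using that by (simp add: degree_def)
  define \<omega> :: "'a set \<Rightarrow> nat" where
    "\<omega> e = 2 * of_bool (e \<in> I) + of_bool (e \<in> J) + 2 * of_bool (e \<in> H)" for e
  define M where "M = I \<union> J \<union> H"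
  have finM: "finite M" using finI finJ finB' HB' finite_subset by (auto simp: M_def)
  have sub: "I \<subseteq> M" "J \<subseteq> M" "H \<subseteq> M" by (auto simp: M_def)
  have wd: "weighted_degree M \<omega> v = 2 * degree I v + degree J v + 2 * degree H v" for v
    unfolding weighted_degree_def \<omega>_def sum.distrib sum_distrib_left[symmetric]
    by (simp only: sum_of_bool_degree[OF finM] sub)
  have IS: "e \<subseteq> S" if "e \<in> I" for e using I that by (auto simp: two_subsets_def)
  have disj: "I \<inter> B = {}"
  proof -
    have "\<not> e \<subseteq> S" if "e \<in> B" for e using B[OF that] ST by auto
    then show ?thesis using IS by blast
  qed
  have "\<omega> e \<in> {1, 2, 3}" if "e \<in> M" for e
    using that disj JB HB' B'B by (auto simp: \<omega>_def M_def)
  moreover have "weighted_degree M \<omega> u \<noteq> weighted_degree M \<omega> v" if uv: "{u, v} \<in> M" for u v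
  \<comment> \<open>Edges of \<open>I\<close> are separated by the colouring \<open>f\<close>, all
    others by parity.\<close>
  proof (cases "{u, v} \<in> I")
    case True
    then have "u \<in> S" "v \<in> S" using IS by auto
    moreover have "u \<noteq> v" using True I by (auto simp: two_subsets_def)
    moreover have "weighted_degree M \<omega> s = f s" if "s \<in> S" for s
      using that K degH by (simp add: wd base_def)
    ultimately show ?thesis using f True by metis
  next
    case False
    then have "{u, v} \<in> B'" using uv JB' HB' by (auto simp: M_def)
    then obtain s t where st: "s \<in> S" "t \<in> T" "{u, v} = {s, t}" and "\<exists>t\<in>T. t \<in> {u, v} \<and> degree J t = 1"
      using B B'B by (fastforce simp: B'_def)
    then have "degree J t = 1" using ST by auto
    moreover have "even (degree J s)" using J st by (simp add: ok_def)
    ultimately have "even (weighted_degree M \<omega> s)" "odd (weighted_degree M \<omega> t)"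
      by (simp_all add: wd)
    then show ?thesis using st(3) by (auto simp: doubleton_eq_iff)
  qed
  ultimately have "fulfills_123 V M" unfolding fulfills_123_def by blast
  moreover have "M \<subseteq> I \<union> B" using JB HB' B'B by (auto simp: M_def)
  ultimately show ?thesis using sub by blast
qed

section \<open>Graphs of bounded chromatic number\<close>

text \<open>An orientation is encoded as a map \<open>h\<close> from edges to their heads, so the
  cardinality of this set is an in-degree.\<close>

definition in_edges :: "'a set set \<Rightarrow> ('a set \<Rightarrow> 'a) \<Rightarrow> 'a \<Rightarrow> 'a set set" where
  "in_edges E h v = {e \<in> E. h e = v}"

text \<open>Reversing one edge flips the parity of the in-degree at both of its ends. Along a walk
  the flips cancel except at \<open>u\<close> and \<open>v\<close>, and everywhere if
  \<open>u = v\<close>; hence the exclusive or.\<close>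

lemma reverse_path:
  assumes fin: "finite E" and E: "E \<subseteq> two_subsets V"
    and h: "\<And>e. e \<in> E \<Longrightarrow> h e \<in> e"
    and path: "(u, v) \<in> {(x, y). {x, y} \<in> E}\<^sup>*"
  shows "\<exists>h'. (\<forall>e\<in>E. h' e \<in> e) \<and> (\<forall>w. odd (card (in_edges E h' w)) \<longleftrightarrow>
    (odd (card (in_edges E h w)) \<noteq> ((w = u) \<noteq> (w = v))))"
  using path
proof (induction rule: rtrancl_induct)
  case base
  then show ?case using h by blast
next
  case (step y z)
  then obtain h' where h': "\<And>e. e \<in> E \<Longrightarrow> h' e \<in> e"
    "\<And>w. odd (card (in_edges E h' w)) \<longleftrightarrow> (odd (card (in_edges E h w)) \<noteq> ((w = u) \<noteq> (w = y)))"
    by blast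
  let ?e = "{y, z}"
  have e: "?e \<in> E" "y \<noteq> z" using step E by (auto simp: two_subsets_def)
  obtain a b where ab: "?e = {a, b}" "h' ?e = a" "a \<noteq> b"
    using h'(1)[OF e(1)] e(2) by blast
  have fin': "finite (in_edges E g w)" for g w using fin by (simp add: in_edges_def)
  have "in_edges E (h'(?e := b)) w = (if w = a then in_edges E h' w - {?e}
      else if w = b then insert ?e (in_edges E h' w) else in_edges E h' w)" for w
    using e ab by (auto simp: in_edges_def)
  moreover have "?e \<in> in_edges E h' a" "?e \<notin> in_edges E h' b"
    using e ab by (auto simp: in_edges_def)
  ultimately have "odd (card (in_edges E (h'(?e := b)) w)) \<longleftrightarrow>
      (odd (card (in_edges E h' w)) \<noteq> (w = a \<or> w = b))" for w
    using fin' card_Suc_Diff1[OF fin'[of h' a], of ?e] ab(3) by auto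
  moreover have "w = a \<or> w = b \<longleftrightarrow> (w = y) \<noteq> (w = z)" for w using ab e by blast
  ultimately have "odd (card (in_edges E (h'(?e := b)) w)) \<longleftrightarrow>
      (odd (card (in_edges E h w)) \<noteq> ((w = u) \<noteq> (w = z)))" for w
    using h'(2)[of w] by blast
  moreover have "(h'(?e := b)) e \<in> e" if "e \<in> E" for e using h'(1) that ab by auto
  ultimately show ?case by blast
qed

text \<open>Take an orientation with the fewest odd in-degrees. If two odd vertices were connected,
  reversing a path between them would make both even and change no other parity.\<close>

lemma orientation_odd_unique:
  assumes fin: "finite V" and E: "E \<subseteq> two_subsets V"
  shows "\<exists>h. (\<forall>e\<in>E. h e \<in> e) \<and> (\<forall>u v. odd (card (in_edges E h u)) \<longrightarrow> odd (card (in_edges E h v)) \<longrightarrow>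
    (u, v) \<in> {(x, y). {x, y} \<in> E}\<^sup>* \<longrightarrow> u = v)"
proof -
  define Od where "Od h = {v. odd (card (in_edges E h v))}" for h
  have "(SOME v. v \<in> e) \<in> e" if "e \<in> E" for e
    using that E by (intro someI_ex[of "\<lambda>v. v \<in> e"]) (auto simp: two_subsets_def card_2_iff)
  then obtain h where h: "\<forall>e\<in>E. h e \<in> e"
    and least: "\<And>h'. \<forall>e\<in>E. h' e \<in> e \<Longrightarrow> card (Od h) \<le> card (Od h')"
    using ex_has_least_nat[of "\<lambda>h. \<forall>e\<in>E. h e \<in> e" "\<lambda>e. SOME v. v \<in> e" "\<lambda>h. card (Od h)"] by blast
  have "Od h \<subseteq> V"
  proof
    fix v assume "v \<in> Od h"
    then have "in_edges E h v \<noteq> {}" unfolding Od_def by (metis card.empty even_zero mem_Collect_eq)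
    then show "v \<in> V" using h E by (fastforce simp: in_edges_def two_subsets_def)
  qed
  then have finO: "finite (Od h)" using fin finite_subset by blast
  have "u = v" if uv: "u \<in> Od h" "v \<in> Od h" "(u, v) \<in> {(x, y). {x, y} \<in> E}\<^sup>*" for u v
  proof (rule ccontr)
    assume "u \<noteq> v"
    obtain h' where h': "\<forall>e\<in>E. h' e \<in> e" "\<forall>w. odd (card (in_edges E h' w)) \<longleftrightarrow>
        (odd (card (in_edges E h w)) \<noteq> ((w = u) \<noteq> (w = v)))"
      using reverse_path[of E V h u v] finite_edges[of V E] fin E h uv by (auto simp: simple_graph_def)
    have "Od h' \<subset> Od h" using h'(2) uv \<open>u \<noteq> v\<close> by (auto simp: Od_def)
    then show False using least[OF h'(1)] psubset_card_mono[OF finO] by (meson leD)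
  qed
  then show ?thesis using h by (auto simp: Od_def)
qed

text \<open>Weight 1 on \<open>e\<close>, 2 on \<open>f\<close> and 3 elsewhere. The centre
  \<open>b\<close> gets at least 5, and any other vertex lies on at most \<open>e\<close> and one
  star edge, so gets at most 4. If \<open>e\<close> misses \<open>b\<close>, its end on
  \<open>f\<close> gets 3 and its other end 1 or 4.\<close>

lemma fulfills_123_star_plus_edge:
  assumes fin: "finite E"
    and star: "\<And>g. g \<in> E \<Longrightarrow> g \<noteq> e \<Longrightarrow> b \<in> g"
    and E: "E \<subseteq> two_subsets V" and e: "e \<in> E"
    and f: "f \<in> E" "f \<noteq> e" "f \<inter> e \<noteq> {}" and g: "g \<in> E" "g \<noteq> e" "g \<noteq> f"
  shows "fulfills_123 V E"
proof -
  define \<omega> :: "'a set \<Rightarrow> nat" where "\<omega> x = (if x = e then 1 else if x = f then 2 else 3)" for x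
  let ?wd = "weighted_degree E \<omega>"
  have two: "card x = 2" if "x \<in> E" for x using E that by (auto simp: two_subsets_def)
  have fin': "finite {x \<in> E. v \<in> x}" for v using fin by simp
  have bfg: "b \<in> f" "b \<in> g" using star f g by auto
  have b5: "?wd b \<ge> 5"
  proof -
    have "(\<Sum>x\<in>{f, g}. \<omega> x) \<le> ?wd b"
      unfolding weighted_degree_def using fin f g bfg by (intro sum_mono2) auto
    then show ?thesis using f g by (simp add: \<omega>_def)
  qed
  have pair: "x = {b, v}" if "x \<in> E" "x \<noteq> e" "v \<in> x" "v \<noteq> b" for x v
    using two[OF that(1)] star[OF that(1,2)] that(3,4) by (auto simp: card_2_iff)
  have star_at: "{x \<in> E. v \<in> x} \<subseteq> {e, {b, v}}" if "v \<noteq> b" for v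
    using pair that by blast
  have le4: "?wd v \<le> 4" if "v \<noteq> b" for v
  proof -
    have "?wd v \<le> (\<Sum>x\<in>{e, {b, v}}. \<omega> x)"
      unfolding weighted_degree_def using star_at[OF that] by (intro sum_mono2) auto
    also have "\<dots> \<le> 4" by (cases "e = {b, v}") (auto simp: \<omega>_def)
    finally show ?thesis .
  qed
  have "?wd u \<noteq> ?wd v" if uv: "{u, v} \<in> E" for u v
  proof (cases "b \<in> {u, v}")
    case True
    moreover have "u \<noteq> v" using two[OF uv] by auto
    ultimately show ?thesis using b5 le4[of u] le4[of v] by auto
  next
    case False
    then have e_uv: "e = {u, v}" using star[OF uv] by blast
    have 3: "?wd x \<noteq> ?wd y" if xy: "e = {x, y}" "x \<in> f" "y \<noteq> b" "x \<noteq> b" for x y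
    proof -
      have fx: "f = {b, x}" using pair[of f x] f xy by auto
      have neq: "x \<noteq> y" using two[OF e] xy by auto
      have "{z \<in> E. x \<in> z} = {e, f}" using star_at[OF xy(4)] f e xy fx by auto
      then have "?wd x = 3" using f(2) by (simp add: weighted_degree_def \<omega>_def)
      have "{b, y} \<noteq> e" "{b, y} \<noteq> f" using xy fx neq by (simp_all add: doubleton_eq_iff)
      then have "(\<Sum>z\<in>{e, {b, y}}. \<omega> z) = 4" "(\<Sum>z\<in>{e}. \<omega> z) = 1" by (simp_all add: \<omega>_def)
      moreover have "{z \<in> E. y \<in> z} = {e} \<or> {z \<in> E. y \<in> z} = {e, {b, y}}"
        using star_at[OF xy(3)] e xy by blast
      ultimately have "?wd y = 1 \<or> ?wd y = 4" unfolding weighted_degree_def by metis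
      then show ?thesis using \<open>?wd x = 3\<close> by linarith
    qed
    have "u \<in> f \<or> v \<in> f" using f(3) e_uv by auto
    then show ?thesis using 3[of u v] 3[of v u] False e_uv by (auto simp: insert_commute)
  qed
  moreover have "\<omega> x \<in> {1, 2, 3}" for x by (simp add: \<omega>_def)
  ultimately show ?thesis unfolding fulfills_123_def by blast
qed

text \<open>The pieces share no vertices, so the sum at an end of an edge is computed within one
  piece. As edges are nonempty, each determines its piece.\<close>

lemma fulfills_123_disjoint_union:
  assumes ful: "\<And>i. i \<in> I \<Longrightarrow> fulfills_123 V (Q i)"
    and disj: "\<And>i j e e'. i \<in> I \<Longrightarrow> j \<in> I \<Longrightarrow> e \<in> Q i \<Longrightarrow> e' \<in> Q j \<Longrightarrow> e \<inter> e' \<noteq> {} \<Longrightarrow> i = j"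
    and ne: "\<And>i. i \<in> I \<Longrightarrow> {} \<notin> Q i"
  shows "fulfills_123 V (\<Union>i\<in>I. Q i)"
proof -
  obtain w where w: "\<And>i e. i \<in> I \<Longrightarrow> e \<in> Q i \<Longrightarrow> w i e \<in> {1, 2, 3::nat}"
    "\<And>i u v. i \<in> I \<Longrightarrow> u \<in> V \<Longrightarrow> v \<in> V \<Longrightarrow> {u, v} \<in> Q i \<Longrightarrow>
      weighted_degree (Q i) (w i) u \<noteq> weighted_degree (Q i) (w i) v"
    using ful unfolding fulfills_123_def by metis
  define \<omega> where "\<omega> e = w (SOME i. i \<in> I \<and> e \<in> Q i) e" for e
  have \<omega>: "\<omega> e = w i e" if "i \<in> I" "e \<in> Q i" for i e
  proof -
    have "(SOME i. i \<in> I \<and> e \<in> Q i) = i"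
      using that ne[OF that(1)] by (intro some_equality) (auto dest: disj[of _ i e e])
    then show ?thesis by (simp add: \<omega>_def)
  qed
  have wd: "weighted_degree (\<Union>i\<in>I. Q i) \<omega> v = weighted_degree (Q i) (w i) v"
    if "i \<in> I" "e \<in> Q i" "v \<in> e" for i e v
  proof -
    have "{x \<in> (\<Union>i\<in>I. Q i). v \<in> x} = {x \<in> Q i. v \<in> x}" using that disj by blast
    then show ?thesis unfolding weighted_degree_def using \<omega> that by (intro sum.cong) auto
  qed
  show ?thesis
    unfolding fulfills_123_def
  proof (intro exI[of _ \<omega>] conjI ballI impI)
    show "\<omega> e \<in> {1, 2, 3}" if "e \<in> (\<Union>i\<in>I. Q i)" for e using that \<omega> w(1) by (metis UN_E)
    show "weighted_degree (\<Union>i\<in>I. Q i) \<omega> u \<noteq> weighted_degree (\<Union>i\<in>I. Q i) \<omega> v"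
      if "u \<in> V" "v \<in> V" "{u, v} \<in> (\<Union>i\<in>I. Q i)" for u v
    proof -
      obtain i where "i \<in> I" "{u, v} \<in> Q i" using \<open>{u, v} \<in> _\<close> by blast
      then show ?thesis using wd[of i "{u, v}"] w(2) that by simp
    qed
  qed
qed

text \<open>Colour classes of heads give bipartite graphs; they only fail at vertices of in-degree one,
  of which there is at most one per component, and such a vertex is absorbed together with a
  neighbouring in-star into the extra part \<open>Q\<close>.\<close>

lemma coloured_decomposition:
  fixes col :: "'a \<Rightarrow> 'c"
  assumes fin: "finite V" and E: "E \<subseteq> two_subsets V"
    and touch: "\<And>e. e \<in> E \<Longrightarrow> \<exists>f\<in>E. f \<noteq> e \<and> f \<inter> e \<noteq> {}"
    and col: "\<And>u v. {u, v} \<in> E \<Longrightarrow> col u \<noteq> col v"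
  shows "\<exists>Q h. Q \<subseteq> E \<and> fulfills_123 V Q \<and> (\<forall>k. fulfills_123 V {e \<in> E - Q. col (h e) = k})"
proof -
  have finE: "finite E" using finite_edges[of V E] fin E by (simp add: simple_graph_def)
  let ?R = "{(x, y). {x, y} \<in> E}"
  have sym: "(v, u) \<in> ?R\<^sup>*" if "(u, v) \<in> ?R\<^sup>*" for u v
    using that by (metis (no_types, lifting) case_prodD case_prodI insert_commute mem_Collect_eq
        symI sym_rtrancl symD)
  have edge_path: "(u, v) \<in> ?R\<^sup>*" if e: "e \<in> E" "u \<in> e" "v \<in> e" for e u v
  proof (cases "u = v")
    case False
    then have "e = {u, v}" using e E by (auto simp: two_subsets_def card_2_iff)
    then show ?thesis using e by auto
  qed simp
  obtain h where h: "\<And>e. e \<in> E \<Longrightarrow> h e \<in> e"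
    and odd1: "\<And>u v. odd (card (in_edges E h u)) \<Longrightarrow> odd (card (in_edges E h v)) \<Longrightarrow> (u, v) \<in> ?R\<^sup>* \<Longrightarrow> u = v"
    using orientation_odd_unique[OF fin E] by metis
  have finin: "finite (in_edges E h v)" for v using finE by (simp add: in_edges_def)
  \<comment> \<open>The exceptional vertices. Their in-degree is odd, so no component contains two
    of them.\<close>
  define Bd where "Bd = {r. card (in_edges E h r) = 1}"
  \<comment> \<open>\<open>q\<close> is closed under equal heads, so removing it leaves each vertex
    either all of its entering edges or none. Staying in the component of \<open>r\<close> keeps
    different pieces disjoint.\<close>
  define absorbs where "absorbs r q \<longleftrightarrow> in_edges E h r \<subseteq> q \<and> q \<subseteq> E \<and> fulfills_123 V q
      \<and> (\<forall>e\<in>q. \<forall>v\<in>e. (r, v) \<in> ?R\<^sup>*) \<and> (\<forall>e\<in>q. \<forall>e'\<in>E. h e' = h e \<longrightarrow> e' \<in> q)" for r q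
  have "\<exists>q. absorbs r q" if r: "r \<in> Bd" for r
  proof -
    obtain e where e: "in_edges E h r = {e}" using r by (auto simp: Bd_def card_1_singleton_iff)
    then have eE: "e \<in> E" "h e = r" by (auto simp: in_edges_def)
    obtain f where f: "f \<in> E" "f \<noteq> e" "f \<inter> e \<noteq> {}" using touch[OF eE(1)] by blast
    define b where "b = h f"
    have fb: "f \<in> in_edges E h b" using f by (simp add: in_edges_def b_def)
    have "b \<noteq> r" using fb e f by auto
    have conn: "(r, v) \<in> ?R\<^sup>*" if "v \<in> e \<union> f" for v
    proof -
      obtain x where x: "x \<in> f" "x \<in> e" using f by blast
      have "(r, x) \<in> ?R\<^sup>*" using edge_path[OF eE(1)] h[OF eE(1)] eE x by simp
      then show ?thesis using that edge_path[OF eE(1), of r v] h[OF eE(1)] eE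
          edge_path[OF f(1), of x v] x by (auto intro: rtrancl_trans)
    qed
    have rb: "(r, b) \<in> ?R\<^sup>*" using conn h[OF f(1)] by (simp add: b_def)
    \<comment> \<open>\<open>r\<close> is the only vertex of odd in-degree in its component, so
      besides \<open>f\<close> a second edge \<open>g\<close> enters \<open>b\<close>.\<close>
    have "even (card (in_edges E h b))"
      using odd1[OF _ _ rb] r \<open>b \<noteq> r\<close> by (auto simp: Bd_def)
    then have "in_edges E h b \<noteq> {f}" by auto
    then obtain g where g: "g \<in> in_edges E h b" "g \<noteq> f" using fb by blast
    have "g \<noteq> e" using g eE \<open>b \<noteq> r\<close> by (auto simp: in_edges_def)
    let ?q = "insert e (in_edges E h b)"
    have inE: "in_edges E h b \<subseteq> E" by (auto simp: in_edges_def)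
    have "fulfills_123 V ?q"
    proof (rule fulfills_123_star_plus_edge[of _ e b _ f g])
      show "b \<in> x" if "x \<in> ?q" "x \<noteq> e" for x using that h by (auto simp: in_edges_def)
      show "?q \<subseteq> two_subsets V" using inE eE E by blast
    qed (use finin fb f g \<open>g \<noteq> e\<close> in simp_all)
    moreover have "(r, v) \<in> ?R\<^sup>*" if "x \<in> ?q" "v \<in> x" for x v
    proof (cases "x = e")
      case False
      then have "x \<in> E" "b \<in> x" using that h by (auto simp: in_edges_def)
      then have "(b, v) \<in> ?R\<^sup>*" using edge_path that by blast
      then show ?thesis using rb by (auto intro: rtrancl_trans)
    qed (use that conn in auto)
    moreover have "e' \<in> ?q" if "x \<in> ?q" "e' \<in> E" "h e' = h x" for x e'
      using that e eE by (auto simp: in_edges_def)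
    moreover have "in_edges E h r \<subseteq> ?q" "?q \<subseteq> E" using e eE inE by auto
    ultimately show ?thesis
      unfolding absorbs_def by (intro exI[of _ ?q] conjI ballI impI) simp_all
  qed
  then obtain q where "\<And>r. r \<in> Bd \<Longrightarrow> absorbs r (q r)" by metis
  then have q: "\<And>r. r \<in> Bd \<Longrightarrow> in_edges E h r \<subseteq> q r"
    "\<And>r. r \<in> Bd \<Longrightarrow> q r \<subseteq> E" "\<And>r. r \<in> Bd \<Longrightarrow> fulfills_123 V (q r)"
    "\<And>r e v. r \<in> Bd \<Longrightarrow> e \<in> q r \<Longrightarrow> v \<in> e \<Longrightarrow> (r, v) \<in> ?R\<^sup>*"
    "\<And>r e e'. r \<in> Bd \<Longrightarrow> e \<in> q r \<Longrightarrow> e' \<in> E \<Longrightarrow> h e' = h e \<Longrightarrow> e' \<in> q r"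
    by (simp_all add: absorbs_def)
  define Q where "Q = (\<Union>r\<in>Bd. q r)"
  have QE: "Q \<subseteq> E" using q(2) by (auto simp: Q_def)
  have "fulfills_123 V Q"
    unfolding Q_def
  proof (rule fulfills_123_disjoint_union)
    fix r r' e e' assume r: "r \<in> Bd" "r' \<in> Bd" "e \<in> q r" "e' \<in> q r'" "e \<inter> e' \<noteq> {}"
    then obtain v where "v \<in> e" "v \<in> e'" by blast
    then have "(r, v) \<in> ?R\<^sup>*" "(r', v) \<in> ?R\<^sup>*" using q(4) r by blast+
    then have "(r, r') \<in> ?R\<^sup>*" using sym by (meson rtrancl_trans)
    then show "r = r'" using odd1 r by (auto simp: Bd_def)
  next
    fix r assume "r \<in> Bd"
    then show "{} \<notin> q r" using q(2) h by fastforce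
  qed (use q in auto)
  moreover have "fulfills_123 V {e \<in> E - Q. col (h e) = k}" for k
  proof (rule fulfills_123_bipartite[of _ _ "{v. col v = k}"])
    let ?C = "{e \<in> E - Q. col (h e) = k}"
    show "finite V" "finite ?C" using fin finE by auto
    show "\<exists>a b. e = {a, b} \<and> a \<in> {v. col v = k} \<and> b \<in> V - {v. col v = k}" if e: "e \<in> ?C" for e
    proof -
      have "h e \<in> e" "e \<in> two_subsets V" using h e E by auto
      then obtain b where b: "e = {h e, b}" "b \<in> V" by (metis two_subsets_otherE)
      then show ?thesis using col[of "h e" b] e by (intro exI[of _ "h e"] exI[of _ b]) auto
    qed
    \<comment> \<open>Since the colouring is proper, every edge of \<open>?C\<close> at
      \<open>a\<close> has head \<open>a\<close>. In-stars survive as a whole, so degree 1 here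
      would be in-degree 1 in \<open>E\<close>, and the edge would lie in \<open>Q\<close>.\<close>
    show "degree ?C a \<noteq> 1" if a: "a \<in> {v. col v = k}" for a
    proof
      assume "degree ?C a = 1"
      then obtain e where e: "{x \<in> ?C. a \<in> x} = {e}" by (auto simp: degree_def card_1_singleton_iff)
      then have e': "e \<in> ?C" "a \<in> e" by auto
      have hd: "h x = a" if "x \<in> ?C" "a \<in> x" for x
      proof (rule ccontr)
        assume "h x \<noteq> a"
        moreover have "h x \<in> x" "x \<in> two_subsets V" using h that E by auto
        ultimately have "x = {a, h x}" using that by (auto simp: two_subsets_def card_2_iff)
        then show False using col[of a "h x"] a that by auto
      qed
      have "x \<in> ?C \<and> a \<in> x" if x: "x \<in> in_edges E h a" for x
      proof -
        have "x \<notin> Q" using q(5)[of _ x e] e' hd[OF e'] x by (auto simp: Q_def in_edges_def)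
        then show ?thesis using x a h by (auto simp: in_edges_def)
      qed
      then have "in_edges E h a \<subseteq> {e}" using e by blast
      moreover have "e \<in> in_edges E h a" using e' hd[OF e'] by (simp add: in_edges_def)
      ultimately have "in_edges E h a = {e}" by blast
      then have "a \<in> Bd" "e \<in> in_edges E h a" by (auto simp: Bd_def)
      then show False using q(1) e' by (auto simp: Q_def)
    qed
  qed
  ultimately show ?thesis using QE by blast
qed

section \<open>Maximum cuts\<close>

text \<open>In a maximum cut, if some edge leaves a vertex set \<open>W\<close>, then so does a cut
  edge: otherwise switching the side of all of \<open>W\<close> would keep every cut edge and gain a
  new one.\<close>

lemma bipartite_subgraph_touching:
  assumes fin: "finite E" and E: "E \<subseteq> two_subsets V"
    and touch: "\<And>e. e \<in> E \<Longrightarrow> \<exists>f\<in>E. f \<noteq> e \<and> f \<inter> e \<noteq> {}"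
  shows "\<exists>c :: 'a \<Rightarrow> bool. \<forall>e\<in>E. \<exists>f\<in>E. f \<noteq> e \<and> f \<inter> e \<noteq> {} \<and> (\<exists>x\<in>f. \<exists>y\<in>f. c x \<noteq> c y)"
proof -
  define cut where "cut c = {e \<in> E. \<exists>x\<in>e. \<exists>y\<in>e. c x \<noteq> c y}" for c :: "'a \<Rightarrow> bool"
  have "\<forall>c. True \<longrightarrow> card (cut c) < Suc (card E)"
    using card_mono[OF fin] by (auto simp: cut_def less_Suc_eq_le)
  then obtain c where maxi: "\<And>c'. card (cut c') \<le> card (cut c)"
    using ex_has_greatest_nat[of "\<lambda>_. True" undefined "\<lambda>c. card (cut c)"] by blast
  have boundary: "\<exists>f\<in>cut c. f \<inter> W \<noteq> {} \<and> \<not> f \<subseteq> W"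
    if e: "e \<in> E" "e \<inter> W \<noteq> {}" "\<not> e \<subseteq> W" for e W
  proof (rule ccontr)
    assume none: "\<not> ?thesis"
    define c' where "c' v = (c v \<noteq> (v \<in> W))" for v
    have "f \<in> cut c'" if f: "f \<in> cut c" for f
    proof -
      have "f \<inter> W = {} \<or> f \<subseteq> W" using none f by blast
      moreover obtain x y where "x \<in> f" "y \<in> f" "c x \<noteq> c y" using f by (auto simp: cut_def)
      ultimately have "c' x \<noteq> c' y" by (auto simp: c'_def)
      then show ?thesis using f \<open>x \<in> f\<close> \<open>y \<in> f\<close> by (auto simp: cut_def)
    qed
    moreover have "e \<notin> cut c" using none e by blast
    moreover have "e \<in> cut c'"
    proof -
      obtain x y where xy: "x \<in> e" "x \<in> W" "y \<in> e" "y \<notin> W" using e by blast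
      then have "c x = c y" using \<open>e \<notin> cut c\<close> e(1) unfolding cut_def by blast
      then have "c' x \<noteq> c' y" using xy by (simp add: c'_def)
      then show ?thesis using xy e(1) unfolding cut_def by blast
    qed
    ultimately have "cut c \<subset> cut c'" by blast
    moreover have "finite (cut c')" using fin by (simp add: cut_def)
    ultimately show False using maxi[of c'] psubset_card_mono by (meson leD)
  qed
  have cut_touch: "\<exists>f\<in>cut c. f \<noteq> e \<and> f \<inter> e \<noteq> {}" if e: "e \<in> E" for e
  proof (cases "e \<in> cut c")
    case True
    obtain g where g: "g \<in> E" "g \<noteq> e" "g \<inter> e \<noteq> {}" using touch[OF e] by blast
    then have "card g = 2" "card e = 2" using e E by (auto simp: two_subsets_def)
    then have "\<not> g \<subseteq> e" using g(2) by (metis card_subset_eq card.infinite zero_neq_numeral)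
    \<comment> \<open>With \<open>W = e\<close>: the edge \<open>g\<close> leaves \<open>e\<close>,
      hence so does a cut edge, which therefore differs from \<open>e\<close>.\<close>
    then show ?thesis using boundary[of g e] g by blast
  next
    case False
    obtain x y where xy: "e = {x, y}" "x \<noteq> y" using e E by (metis subsetD two_subsetsE)
    then obtain f where "f \<in> cut c" "f \<inter> {x} \<noteq> {}" using boundary[of e "{x}"] e by auto
    moreover have "f \<noteq> e" using \<open>f \<in> cut c\<close> False by auto
    moreover have "f \<inter> e \<noteq> {}" using \<open>f \<inter> {x} \<noteq> {}\<close> xy by auto
    ultimately show ?thesis by metis
  qed
  show ?thesis
  proof (intro exI[of _ c] ballI)
    fix e assume "e \<in> E"
    then obtain f where f: "f \<in> cut c" "f \<noteq> e" "f \<inter> e \<noteq> {}" using cut_touch by blast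
    from f(1) have "f \<in> E" "\<exists>x\<in>f. \<exists>y\<in>f. c x \<noteq> c y" by (simp_all add: cut_def)
    with f show "\<exists>f\<in>E. f \<noteq> e \<and> f \<inter> e \<noteq> {} \<and> (\<exists>x\<in>f. \<exists>y\<in>f. c x \<noteq> c y)"
      by (intro bexI[of _ f] conjI)
  qed
qed

text \<open>Minimise the number of monochromatic edges. Moving \<open>v\<close> to class
  \<open>j\<close> affects only the edges at \<open>v\<close>, so it cannot have fewer edges to
  class \<open>j\<close> than to its own.\<close>

lemma max_multicut:
  assumes fin: "finite E" and E: "E \<subseteq> two_subsets V" and k: "k > 0"
  shows "\<exists>p :: 'a \<Rightarrow> nat. (\<forall>v. p v < k) \<and> (\<forall>v. \<forall>j<k.
    card {e \<in> E. v \<in> e \<and> (\<forall>u\<in>e - {v}. p u = p v)} \<le> card {e \<in> E. v \<in> e \<and> (\<forall>u\<in>e - {v}. p u = j)})"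
proof -
  define mon where "mon p = {e \<in> E. \<exists>i. \<forall>u\<in>e. p u = i}" for p :: "'a \<Rightarrow> nat"
  obtain p where p: "\<forall>v. p v < k" and least: "\<And>p'. \<forall>v. p' v < k \<Longrightarrow> card (mon p) \<le> card (mon p')"
    using ex_has_least_nat[of "\<lambda>p. \<forall>v. p v < k" "\<lambda>_. 0" "\<lambda>p. card (mon p)"] k by auto
  have "card {e \<in> E. v \<in> e \<and> (\<forall>u\<in>e - {v}. p u = p v)} \<le> card {e \<in> E. v \<in> e \<and> (\<forall>u\<in>e - {v}. p u = j)}"
    if j: "j < k" for v j
  proof -
    let ?A = "{e \<in> E. v \<notin> e \<and> (\<exists>i. \<forall>u\<in>e. p u = i)}"
    let ?N = "\<lambda>j. {e \<in> E. v \<in> e \<and> (\<forall>u\<in>e - {v}. p u = j)}"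
    have "mon p = ?A \<union> ?N (p v)" by (auto simp: mon_def)
    moreover have "mon (p(v := j)) = ?A \<union> ?N j" by (auto simp: mon_def)
    moreover have "card (?A \<union> ?N i) = card ?A + card (?N i)" for i
      using fin by (intro card_Un_disjoint) auto
    ultimately show ?thesis using least[of "p(v := j)"] p j by simp
  qed
  then show ?thesis using p by blast
qed

text \<open>If no other edge meets \<open>e\<close>, nothing outside \<open>e\<close> is reachable
  from its ends, so \<open>e\<close> is a component and a copy of \<open>K\<^sub>2\<close>.\<close>

lemma no_isolated_edge_touching:
  assumes G: "simple_graph V E" and iso: "\<nexists>C. isolated_edge V E C" and e: "e \<in> E"
  shows "\<exists>f\<in>E. f \<noteq> e \<and> f \<inter> e \<noteq> {}"
proof (rule ccontr)
  assume none: "\<not> ?thesis"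
  have "e \<in> two_subsets V" using G e by (auto simp: simple_graph_def)
  then obtain u v where uv: "e = {u, v}" "u \<noteq> v" "u \<in> V" "v \<in> V" by (rule two_subsetsE)
  have "x \<in> e" if "(u, x) \<in> {(x, y). {x, y} \<in> E}\<^sup>*" for x
    using that
  proof (induction rule: rtrancl_induct)
    case (step y z)
    then have "{y, z} \<in> E" "{y, z} \<inter> e \<noteq> {}" by auto
    then have "{y, z} = e" using none by metis
    then show ?case by auto
  qed (simp add: uv)
  then have "connectivity V E `` {u} \<subseteq> e" unfolding connectivity_def by blast
  moreover have "(u, v) \<in> {(x, y). {x, y} \<in> E}\<^sup>*" using uv e by (intro r_into_rtrancl) simp
  then have "e \<subseteq> connectivity V E `` {u}" using uv unfolding connectivity_def by simp
  ultimately have "connectivity V E `` {u} = e" by (rule subset_antisym)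
  then have "e \<in> components V E" using uv(3) unfolding components_def by (metis quotientI)
  moreover have "graph_isomorphic e (induced_edges E e) {..<2::nat} (two_subsets {..<2})"
    unfolding graph_isomorphic_def
  proof (intro exI conjI ballI)
    let ?f = "\<lambda>x. if x = u then 0 else 1 :: nat"
    show "bij_betw ?f e {..<2}" using uv by (auto simp: bij_betw_def inj_on_def)
    fix x y assume xy: "x \<in> e" "y \<in> e"
    have "card {x, x} \<noteq> 2" for x :: 'a by simp
    then have "{x, x} \<notin> E" for x using G by (auto simp: simple_graph_def two_subsets_def)
    then show "{x, y} \<in> induced_edges E e \<longleftrightarrow> {?f x, ?f y} \<in> two_subsets {..<2}"
      using xy uv e by (auto simp: induced_edges_def two_subsets_def insert_commute)
  qed
  ultimately show False using iso by (auto simp: isolated_edge_def)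
qed

section \<open>Assembly of the decomposition\<close>

theorem theorem8:
  fixes V :: "'a set" and E :: "'a set set"
  assumes "simple_graph V E"
    and "\<nexists>C. isolated_edge V E C"
  shows "\<exists>D. decomposition E 24 D \<and> (\<forall>i<24. fulfills_123 V (D i))"
proof -
  have finV: "finite V" and E: "E \<subseteq> two_subsets V" and finE: "finite E"
    using assms(1) finite_edges by (auto simp: simple_graph_def)
  obtain c :: "'a \<Rightarrow> bool" where
    c: "\<And>e. e \<in> E \<Longrightarrow> \<exists>f\<in>E. f \<noteq> e \<and> f \<inter> e \<noteq> {} \<and> (\<exists>x\<in>f. \<exists>y\<in>f. c x \<noteq> c y)"
    using bipartite_subgraph_touching[OF finE E] no_isolated_edge_touching[OF assms] by metis
  define G where "G = {e \<in> E. \<forall>x\<in>e. \<forall>y\<in>e. c x = c y}"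
  have finG: "finite G" and GE: "G \<subseteq> E" and G: "G \<subseteq> two_subsets V" using finE E by (auto simp: G_def)
  \<comment> \<open>The uncut edges that join \<open>v\<close> to class \<open>j\<close>.\<close>
  define N where "N p v j = {e \<in> G. v \<in> e \<and> (\<forall>u\<in>e - {v}. p u = j)}" for p :: "'a \<Rightarrow> nat" and v j
  obtain p :: "'a \<Rightarrow> nat" where p5: "\<And>v. p v < 5"
    and p: "\<And>v j. j < 5 \<Longrightarrow> card (N p v (p v)) \<le> card (N p v j)"
    using max_multicut[OF finG G, of 5] by (auto simp: N_def)
  define S where "S i = {v \<in> V. p v = i}" for i
  \<comment> \<open>Two distinct residues modulo 5 differ by 1 or 2 in exactly one direction, so
    each pair of classes serves only one \<open>i\<close>. Two classes opposite \<open>S i\<close>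
    supply the factor 2 in the degree condition.\<close>
  define T where "T i = {v \<in> V. p v = (i + 1) mod 5 \<or> p v = (i + 2) mod 5}" for i
  define I where "I i = {e \<in> G. e \<subseteq> S i}" for i
  define B where "B i = {e \<in> G. \<exists>s\<in>S i. \<exists>t\<in>T i. e = {s, t}}" for i
  have "\<exists>M. I i \<subseteq> M \<and> M \<subseteq> I i \<union> B i \<and> fulfills_123 V M" if i: "i < 5" for i
  proof (rule fulfills_123_cut)
    have i5: "i \<in> {0, 1, 2, 3, 4}" using i by auto
    show "finite (S i)" "finite (T i)" using finV by (auto simp: S_def T_def)
    show "S i \<inter> T i = {}" using i5 by (auto simp: S_def T_def)
    show "I i \<subseteq> two_subsets (S i)" using G by (auto simp: I_def two_subsets_def)
    show "\<exists>s\<in>S i. \<exists>t\<in>T i. e = {s, t}" if "e \<in> B i" for e using that by (simp add: B_def)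
    show "2 * degree (I i) s \<le> degree (B i) s" if s: "s \<in> S i" for s
    proof -
      let ?j = "(i + 1) mod 5" and ?k = "(i + 2) mod 5"
      have ps: "p s = i" "s \<in> V" using s by (auto simp: S_def)
      have other: "\<exists>u\<in>V. e = {s, u} \<and> u \<noteq> s" if "e \<in> G" "s \<in> e" for e
        using that G by (metis subsetD two_subsets_otherE)
      have "{e \<in> I i. s \<in> e} \<subseteq> N p s (p s)" using ps by (auto simp: I_def N_def S_def)
      then have 1: "degree (I i) s \<le> card (N p s (p s))"
        unfolding degree_def using finG by (intro card_mono) (auto simp: N_def)
      have "e \<in> B i \<and> s \<in> e" if e: "e \<in> N p s ?j \<union> N p s ?k" for e
      proof -
        have "e \<in> G" "s \<in> e" using e by (auto simp: N_def)
        then obtain u where "u \<in> V" "e = {s, u}" "u \<noteq> s" using other by blast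
        then show ?thesis using e s by (auto simp: B_def T_def N_def)
      qed
      then have "card (N p s ?j \<union> N p s ?k) \<le> degree (B i) s"
        unfolding degree_def using finG by (intro card_mono) (auto simp: B_def)
      moreover have "N p s ?j \<inter> N p s ?k = {}"
      proof -
        have False if e: "e \<in> N p s ?j" "e \<in> N p s ?k" for e
        proof -
          obtain u where "e = {s, u}" "u \<noteq> s" using other e by (auto simp: N_def)
          then have "?j = ?k" using e by (simp add: N_def)
          then show False using i5 by auto
        qed
        then show ?thesis by blast
      qed
      then have "card (N p s ?j \<union> N p s ?k) = card (N p s ?j) + card (N p s ?k)"
        using finG by (intro card_Un_disjoint) (auto simp: N_def)
      ultimately show ?thesis using 1 p[of ?j s] p[of ?k s] by simp
    qed
  qed
  then obtain M where M: "\<And>i. i < 5 \<Longrightarrow> I i \<subseteq> M i" "\<And>i. i < 5 \<Longrightarrow> M i \<subseteq> I i \<union> B i"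
    "\<And>i. i < 5 \<Longrightarrow> fulfills_123 V (M i)"
    by metis
  have MG: "M i \<subseteq> G" if "i < 5" for i using M(2)[OF that] by (auto simp: I_def B_def)
  \<comment> \<open>For \<open>i\<close> and \<open>j\<close> distinct, \<open>i - j\<close> and
    \<open>j - i\<close> would both be 1 or 2 modulo 5, but then their sum could not be 0.\<close>
  have Mdisj: "i = j" if ij: "i < 5" "j < 5" and e: "e \<in> M i" "e \<in> M j" for i j e
  proof -
    have parts: "\<exists>u v. e = {u, v} \<and> p u = a \<and> (p v = a \<or> p v = (a + 1) mod 5 \<or> p v = (a + 2) mod 5)"
      if a: "a < 5" "e \<in> M a" for a
    proof -
      have "e \<in> I a \<union> B a" "e \<in> two_subsets V" using a M(2) MG G by blast+
      then show ?thesis by (elim two_subsetsE) (fastforce simp: I_def B_def S_def T_def)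
    qed
    obtain u v where 1: "e = {u, v}" "p u = i" "p v = i \<or> p v = (i + 1) mod 5 \<or> p v = (i + 2) mod 5"
      using parts ij e by blast
    obtain x y where 2: "e = {x, y}" "p x = j" "p y = j \<or> p y = (j + 1) mod 5 \<or> p y = (j + 2) mod 5"
      using parts ij e by blast
    have "u = x \<or> u = y \<and> v = x" using 1(1) 2(1) by (simp add: doubleton_eq_iff) blast
    then show ?thesis
    proof
      assume "u = y \<and> v = x"
      then have "j = i \<or> j = (i + 1) mod 5 \<or> j = (i + 2) mod 5"
        "i = j \<or> i = (j + 1) mod 5 \<or> i = (j + 2) mod 5" using 1 2 by simp_all
      moreover have "i \<in> {0, 1, 2, 3, 4}" "j \<in> {0, 1, 2, 3, 4}" using ij by auto
      ultimately show ?thesis by auto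
    qed (use 1 2 in simp)
  qed
  define L where "L = E - (\<Union>i<5. M i)"
  have LE: "L \<subseteq> E" and L: "L \<subseteq> two_subsets V" using E by (auto simp: L_def)
  \<comment> \<open>The parts \<open>M i\<close> contain uncut edges only, so the cut edges all
    remain and touch every edge of \<open>L\<close>.\<close>
  have cutL: "f \<in> L" if "f \<in> E" "x \<in> f" "y \<in> f" "c x \<noteq> c y" for f x y
    using that MG by (fastforce simp: L_def G_def)
  \<comment> \<open>The pair of side and class as a number below 10. An edge on which both agree
    lies in some \<open>I i\<close>, so it has been removed.\<close>
  define col where "col v = p v + (if c v then 5 else 0)" for v
  have touchL: "\<exists>f\<in>L. f \<noteq> e \<and> f \<inter> e \<noteq> {}" if e: "e \<in> L" for e
  proof -
    obtain f where "f \<in> E" "f \<noteq> e" "f \<inter> e \<noteq> {}" "\<exists>x\<in>f. \<exists>y\<in>f. c x \<noteq> c y"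
      using c[of e] e LE by blast
    then show ?thesis using cutL by blast
  qed
  have colL: "col u \<noteq> col v" if uv: "{u, v} \<in> L" for u v
  proof
    assume "col u = col v"
    then have eq: "c u = c v" "p u = p v"
      using p5[of u] p5[of v] by (auto simp: col_def split: if_splits)
    have "{u, v} \<in> E" "u \<in> V" "v \<in> V" using uv LE L by (auto simp: two_subsets_def)
    then have "{u, v} \<in> I (p u)" using eq by (auto simp: I_def G_def S_def)
    then show False using uv M(1) p5 by (auto simp: L_def)
  qed
  have "\<exists>Q h. Q \<subseteq> L \<and> fulfills_123 V Q \<and> (\<forall>k. fulfills_123 V {e \<in> L - Q. col (h e) = k})"
    by (rule coloured_decomposition[OF finV L touchL colL])
  then obtain Q h where Q: "Q \<subseteq> L" "fulfills_123 V Q"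
    "\<And>k. fulfills_123 V {e \<in> L - Q. col (h e) = k}"
    by blast
  \<comment> \<open>All colours are below 10, so the parts with index 16 to 23 are empty.\<close>
  define D where "D i = (if i < 5 then M i else if i = 5 then Q else {e \<in> L - Q. col (h e) = i - 6})" for i
  have "fulfills_123 V (D i)" for i using M(3) Q by (simp add: D_def)
  moreover have "decomposition E 24 D"
    unfolding decomposition_def
  proof
    have DE: "D i \<subseteq> E" for i using MG GE Q(1) LE by (auto simp: D_def)
    have "\<exists>i<24. e \<in> D i" if e: "e \<in> E" for e
    proof -
      consider i where "i < 5" "e \<in> M i" | "e \<in> Q" | "e \<in> L - Q" using e by (auto simp: L_def)
      then show ?thesis
      proof cases
        case 1
        then show ?thesis by (intro exI[of _ i]) (simp add: D_def)
      next
        case 2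
        then show ?thesis by (intro exI[of _ 5]) (simp add: D_def)
      next
        case 3
        have "col (h e) < 10" using p5[of "h e"] by (simp add: col_def)
        then show ?thesis using 3 by (intro exI[of _ "col (h e) + 6"]) (simp add: D_def)
      qed
    qed
    then show "(\<Union>i<24. D i) = E" using DE by blast
    have "i = j" if "e \<in> D i" "e \<in> D j" for e i j
    proof -
      have *: "i < 5 \<and> e \<in> M i \<or> i = 5 \<and> e \<in> Q \<or> i = col (h e) + 6 \<and> e \<in> L - Q" if "e \<in> D i" for i
        using that by (auto simp: D_def split: if_splits)
      have "e \<notin> L" if "i < 5" "e \<in> M i" for i using that by (auto simp: L_def)
      then show ?thesis using *[OF that(1)] *[OF that(2)] Mdisj[of i j e] Q(1) by blast
    qed
    then show "disjoint_family_on D {..<24}" by (auto simp: disjoint_family_on_def)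
  qed
  ultimately show ?thesis by blast
qed

end
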